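(* Let $H=\triangle+V$ act on $\ell^2(\mathbb{Z})$, with $V\in\ell^\infty(\mathbb{Z},\mathbb{R})$. Assume that for each $E\in\sigma(H)$ one has $\lim_{k\to\infty}\|P_k(E)^{-1}\|=0$ and $\lim_{k\to\infty}\det P_k(E)=\infty$. Let $\eta>0$, $a>3$, $\tau>4$, and let $b\in\ell^\infty(\mathbb{Z},\mathbb{R})$ be such that $$|b(n)|\le\eta\,(a+2\|V\|_\infty)^{-\tau n},\qquad n\ge1.$$ Let $|\kappa|\le1/\|b\|_\infty$ ($\kappa\in\mathbb{R}$) and let $H^\kappa=H+\kappa b$. Then there exist universal constants $\gamma,\gamma'>0$ such that for every $k\ge1$ and every $E\in\sigma(H^\kappa)$: (i) $\gamma^{-1}\|P_k(E)\|\le\|P_k^\kappa(E)\|\le\gamma\|P_k(E)\|$; (ii) ${\gamma'}^{-1}\det P_k(E)\le\det P_k^\kappa(E)\le\gamma'\det P_k(E)$, where $P_k(E)$ and $P_k^\kappa(E)$ are the matrices associated with $H$ and $H^\kappa$, respectively, as defined in the context.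
   Context: $(Hu)(n)=u(n+1)+u(n-1)+V(n)u(n)$, $n\in\mathbb{Z}$; $\sigma(\cdot)$ is the spectrum; $\|\cdot\|$ on $2\times2$ matrices is the Frobenius norm $\|A\|=\sqrt{\operatorname{tr}(AA^* )}$. "Universal" means independent of $k$ and $E$. For a potential $W$ (here $W=V$ for $H$ and $W=V+\kappa b$ for $H^\kappa$), the transfer matrix is, for $n\ge1$, $T(E,n,0)=A_nA_{n-1}\cdots A_1$ with $A_n=\begin{pmatrix}E-W(n)&-1\\1&0\end{pmatrix}$. For $k\ge1$ and $E\in\mathbb{R}$, $$P_k(E)=\sum_{n=1}^kT^*(E,2n-1,0)\,T(E,2n-1,0),$$ where $T$ is the transfer matrix of $H$ and $^*$ is the conjugate transpose; $P_k^\kappa(E)$ is defined by the same formula with the transfer matrix of $H^\kappa$. *)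

theory Defs
  imports "HOL-Analysis.Analysis"
begin

definition ell2 :: "(int \<Rightarrow> complex) set" where
  "ell2 = {u. (\<lambda>n. (cmod (u n))\<^sup>2) summable_on UNIV}"

definition ell2_norm :: "(int \<Rightarrow> complex) \<Rightarrow> real" where
  "ell2_norm u = sqrt (\<Sum>\<^sub>\<infinity>n. (cmod (u n))\<^sup>2)"

text \<open>Operators on the complex Hilbert space of square-summable sequences are functions on all
  sequences of which only the restriction to \<^const>\<open>ell2\<close> matters.\<close>

definition bounded_operator_on_ell2 :: "((int \<Rightarrow> complex) \<Rightarrow> (int \<Rightarrow> complex)) \<Rightarrow> bool" where
  "bounded_operator_on_ell2 R \<longleftrightarrow>
     (\<forall>u\<in>ell2. R u \<in> ell2) \<and>
     (\<forall>u\<in>ell2. \<forall>v\<in>ell2. R (\<lambda>n. u n + v n) = (\<lambda>n. R u n + R v n)) \<and>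
     (\<forall>c. \<forall>u\<in>ell2. R (\<lambda>n. c * u n) = (\<lambda>n. c * R u n)) \<and>
     (\<exists>C. \<forall>u\<in>ell2. ell2_norm (R u) \<le> C * ell2_norm u)"

definition resolvent_set :: "((int \<Rightarrow> complex) \<Rightarrow> (int \<Rightarrow> complex)) \<Rightarrow> complex set" where
  "resolvent_set A = {z. \<exists>R. bounded_operator_on_ell2 R \<and>
     (\<forall>u\<in>ell2. R (\<lambda>n. A u n - z * u n) = u) \<and>
     (\<forall>u\<in>ell2. (\<lambda>n. A (R u) n - z * R u n) = u)}"

definition spectrum :: "((int \<Rightarrow> complex) \<Rightarrow> (int \<Rightarrow> complex)) \<Rightarrow> complex set" where
  "spectrum A = - resolvent_set A"

definition schroedinger :: "(int \<Rightarrow> real) \<Rightarrow> (int \<Rightarrow> complex) \<Rightarrow> (int \<Rightarrow> complex)" where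
  "schroedinger W u = (\<lambda>n. u (n + 1) + u (n - 1) + complex_of_real (W n) * u n)"

text \<open>The supremum norm; meaningful only for bounded \<open>W\<close>.\<close>

definition sup_norm :: "(int \<Rightarrow> real) \<Rightarrow> real" where
  "sup_norm W = (SUP n. \<bar>W n\<bar>)"

text \<open>Energies and potentials are real, so the matrices below are real and the conjugate transpose
  is \<^const>\<open>transpose\<close>.\<close>

definition frobenius_norm :: "real^2^2 \<Rightarrow> real" where
  "frobenius_norm A = sqrt (trace (A ** transpose A))"

definition transfer_step :: "(int \<Rightarrow> real) \<Rightarrow> real \<Rightarrow> int \<Rightarrow> real^2^2" where
  "transfer_step W E n = vector [vector [E - W n, - 1], vector [1, 0]]"

text \<open>\<open>transfer_matrix W E n\<close> is the transfer matrix \<open>T(E, n, 0)\<close> from site 0 to site \<open>n\<close>.\<close>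

primrec transfer_matrix :: "(int \<Rightarrow> real) \<Rightarrow> real \<Rightarrow> nat \<Rightarrow> real^2^2" where
  "transfer_matrix W E 0 = mat 1"
| "transfer_matrix W E (Suc n) = transfer_step W E (int (Suc n)) ** transfer_matrix W E n"

text \<open>Every summand is positive definite (transfer matrices have determinant 1), so for \<open>k \<ge> 1\<close> the
  matrix \<open>P_matrix W E k\<close> is invertible and its \<^const>\<open>matrix_inv\<close> is a genuine inverse.\<close>

definition P_matrix :: "(int \<Rightarrow> real) \<Rightarrow> real \<Rightarrow> nat \<Rightarrow> real^2^2" where
  "P_matrix W E k =
     (\<Sum>n=1..k. transpose (transfer_matrix W E (2 * n - 1)) ** transfer_matrix W E (2 * n - 1))"

end

theory Submission
  imports Defs
begin

text \<open>
  Write the transfer matrix of the perturbed operator as \<open>S n = T n Q n\<close>. Energies in the perturbed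
  spectrum are bounded (by a Neumann series), so \<open>T n\<close> and its inverse grow at most like
  \<open>(M + 1) ^ n\<close> with \<open>M = a + 2 \<parallel>V\<parallel>\<close>, whereas the perturbation decays like \<open>M ^ (- 4 n)\<close>. Hence \<open>Q\<close> is
  bounded by variation of constants, and since \<open>(M + 1) ^ 3 < M ^ 4\<close> even the errors
  \<open>T n (Q n - Q m)\<close>, \<open>n \<le> m\<close>, are square summable. With \<open>X\<close> the last \<open>Q\<close> that occurs, the
  perturbed \<open>P\<close> is therefore, as a quadratic form, at most a constant times the conjugate by \<open>X\<close>
  of the unperturbed one. As \<open>det X = 1\<close>, this compares determinants as well as norms, and
  \<open>T n = S n (Q n)^{-1}\<close> gives the reverse inequalities in the same way.
\<close>

section \<open>The spectrum of a Schroedinger operator is bounded\<close>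

lemma ell2_L2_set_le:
  assumes "u \<in> ell2" "finite F"
  shows "L2_set (\<lambda>n. cmod (u n)) F \<le> ell2_norm u"
  using assms unfolding L2_set_def ell2_norm_def ell2_def
  by (auto intro!: real_sqrt_le_mono finite_sum_le_infsum)

text \<open>The way back from finite sections: a bound uniform in \<open>F\<close> bounds all
  partial sums of the squares. Thus triangle inequalities are only ever applied to
  \<open>L2_set\<close> over finite sets.\<close>

lemma ell2I:
  assumes "\<And>F. finite F \<Longrightarrow> L2_set (\<lambda>n. cmod (u n)) F \<le> B"
  shows "u \<in> ell2" and "ell2_norm u \<le> B"
proof -
  have B: "B \<ge> 0" using assms[of "{}"] by simp
  have le: "(\<Sum>n\<in>F. (cmod (u n))\<^sup>2) \<le> B\<^sup>2" if "finite F" for F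
    using assms[OF that] B unfolding L2_set_def by (metis sqrt_le_D)
  then have summ: "(\<lambda>n. (cmod (u n))\<^sup>2) summable_on UNIV"
    by (intro nonneg_bounded_partial_sums_imp_summable_on[where C = "B\<^sup>2"])
       (auto intro: eventually_finite_subsets_at_top_weakI)
  then show "u \<in> ell2" by (simp add: ell2_def)
  have "(\<Sum>\<^sub>\<infinity>n. (cmod (u n))\<^sup>2) \<le> B\<^sup>2"
    by (rule infsum_le_finite_sums[OF summ]) (use le in auto)
  then show "ell2_norm u \<le> B"
    unfolding ell2_norm_def using B by (rule real_le_lsqrt[rotated -1])
qed

text \<open>The operator is the sum of two shifts, which only move the finite section, and a
  multiplication by a function of size at most \<open>w\<close>.\<close>

lemma schroedinger_ell2:
  assumes W: "\<And>n. \<bar>W n\<bar> \<le> w" and u: "u \<in> ell2"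
  shows "schroedinger W u \<in> ell2" and "ell2_norm (schroedinger W u) \<le> (2 + w) * ell2_norm u"
proof -
  have "L2_set (\<lambda>n. cmod (schroedinger W u n)) F \<le> (2 + w) * ell2_norm u" if F: "finite F" for F
  proof -
    have w: "w \<ge> 0" using W[of 0] by linarith
    have shift: "L2_set (\<lambda>n. cmod (u (n + c))) F = L2_set (\<lambda>n. cmod (u n)) ((\<lambda>n. n + c) ` F)" for c
      unfolding L2_set_def by (subst sum.reindex) (auto simp: inj_on_def)
    have "L2_set (\<lambda>n. cmod (schroedinger W u n)) F
        \<le> L2_set (\<lambda>n. (cmod (u (n + 1)) + cmod (u (n + - 1))) + w * cmod (u n)) F"
    proof (rule L2_set_mono)
      fix n
      have "cmod (schroedinger W u n)
          \<le> cmod (u (n + 1)) + cmod (u (n - 1)) + cmod (complex_of_real (W n) * u n)"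
        unfolding schroedinger_def by (meson add_mono norm_triangle_ineq norm_triangle_mono order_refl)
      also have "cmod (complex_of_real (W n) * u n) \<le> w * cmod (u n)"
        using W[of n] by (simp add: norm_mult mult_right_mono)
      finally show "cmod (schroedinger W u n)
          \<le> (cmod (u (n + 1)) + cmod (u (n + - 1))) + w * cmod (u n)" by simp
    qed simp
    also have "\<dots> \<le> L2_set (\<lambda>n. cmod (u (n + 1)) + cmod (u (n + - 1))) F
        + L2_set (\<lambda>n. w * cmod (u n)) F"
      by (rule L2_set_triangle_ineq)
    also have "\<dots> \<le> (L2_set (\<lambda>n. cmod (u (n + 1))) F + L2_set (\<lambda>n. cmod (u (n + - 1))) F)
        + w * L2_set (\<lambda>n. cmod (u n)) F"
      using w by (intro add_mono L2_set_triangle_ineq) (simp add: L2_set_right_distrib)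
    also have "\<dots> \<le> (ell2_norm u + ell2_norm u) + w * ell2_norm u"
      unfolding shift using w F u by (intro add_mono mult_left_mono ell2_L2_set_le) auto
    finally show ?thesis by (simp add: algebra_simps)
  qed
  then show "schroedinger W u \<in> ell2" "ell2_norm (schroedinger W u) \<le> (2 + w) * ell2_norm u"
    by (blast intro: ell2I)+
qed

section \<open>Powers of the operator and the Neumann series\<close>

lemma schroedinger_lincomb:
  "schroedinger W (\<lambda>n. c * u n + d * v n) = (\<lambda>n. c * schroedinger W u n + d * schroedinger W v n)"
  by (simp add: schroedinger_def algebra_simps)

lemma schroedinger_funpow_lincomb:
  "(schroedinger W ^^ j) (\<lambda>n. c * u n + d * v n)
    = (\<lambda>n. c * (schroedinger W ^^ j) u n + d * (schroedinger W ^^ j) v n)"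
  by (induction j) (simp_all add: schroedinger_lincomb)

lemma schroedinger_funpow_ell2:
  assumes W: "\<And>n. \<bar>W n\<bar> \<le> w" and u: "u \<in> ell2"
  shows "(schroedinger W ^^ j) u \<in> ell2"
    and "ell2_norm ((schroedinger W ^^ j) u) \<le> (2 + w) ^ j * ell2_norm u"
proof (induction j)
  case (Suc j)
  have w: "w \<ge> 0" using W[of 0] by linarith
  { case 1 show ?case using schroedinger_ell2(1)[OF W Suc(1)] by simp }
  { case 2
    have "ell2_norm ((schroedinger W ^^ Suc j) u) \<le> (2 + w) * ell2_norm ((schroedinger W ^^ j) u)"
      using schroedinger_ell2(2)[OF W Suc(1)] by simp
    also have "\<dots> \<le> (2 + w) * ((2 + w) ^ j * ell2_norm u)"
      using Suc(2) w by (intro mult_left_mono) auto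
    finally show ?case by (simp add: mult.assoc) }
qed (use u in auto)

text \<open>The expansion of the inverse of \<open>H - z\<close> in powers of \<open>1 / z\<close>,
  summed at each site separately; the minus sign is there because \<open>resolvent_set\<close>
  inverts \<open>A - z\<close> and not \<open>z - A\<close>.\<close>

definition neumann :: "(int \<Rightarrow> real) \<Rightarrow> complex \<Rightarrow> (int \<Rightarrow> complex) \<Rightarrow> int \<Rightarrow> complex" where
  "neumann W z f n = - (\<Sum>j. (schroedinger W ^^ j) f n / z ^ Suc j)"

context
  fixes W :: "int \<Rightarrow> real" and w :: real and z :: complex
  assumes W: "\<And>n. \<bar>W n\<bar> \<le> w" and z: "cmod z > 2 + w"
begin

private lemma z0: "z \<noteq> 0" "0 \<le> w"
  using z W[of 0] by (auto simp: abs_le_iff)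

private abbreviation (input) "H \<equiv> schroedinger W"

private lemma term_bound:
  assumes "f \<in> ell2" "finite F"
  shows "L2_set (\<lambda>n. cmod ((H ^^ j) f n / z ^ Suc j)) F
    \<le> ell2_norm f / cmod z * ((2 + w) / cmod z) ^ j"
proof -
  have "L2_set (\<lambda>n. cmod ((H ^^ j) f n / z ^ Suc j)) F
      = L2_set (\<lambda>n. cmod ((H ^^ j) f n)) F * (1 / cmod z ^ Suc j)"
    by (subst L2_set_left_distrib) (auto simp: norm_divide norm_power norm_mult)
  also have "\<dots> \<le> ((2 + w) ^ j * ell2_norm f) * (1 / cmod z ^ Suc j)"
    using order_trans[OF ell2_L2_set_le[OF schroedinger_funpow_ell2(1)[OF W assms(1)] assms(2)]
        schroedinger_funpow_ell2(2)[OF W assms(1)]]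
    by (intro mult_right_mono) auto
  also have "\<dots> = ell2_norm f / cmod z * ((2 + w) / cmod z) ^ j"
    by (simp add: power_divide)
  finally show ?thesis .
qed

private lemma ratio: "norm ((2 + w) / cmod z) < 1"
  using z z0 by (simp add: abs_of_nonneg)

private lemma neumann_sums:
  assumes "f \<in> ell2"
  shows "(\<lambda>j. (H ^^ j) f n / z ^ Suc j) sums (- neumann W z f n)"
proof -
  have "summable (\<lambda>j. (H ^^ j) f n / z ^ Suc j)"
  proof (rule summable_comparison_test')
    show "summable (\<lambda>j. ell2_norm f / cmod z * ((2 + w) / cmod z) ^ j)"
      using ratio by (intro summable_mult summable_geometric)
    show "norm ((H ^^ j) f n / z ^ Suc j) \<le> ell2_norm f / cmod z * ((2 + w) / cmod z) ^ j" for j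
      \<comment> \<open>The one-point section turns the \<open>ell2\<close> estimate into a
        pointwise one.\<close>
      using term_bound[OF assms, of "{n}" j] by simp
  qed
  then show ?thesis by (simp add: neumann_def summable_sums)
qed

text \<open>On a finite section the partial sums are bounded by a geometric series through the
  triangle inequality. The limit in \<open>J\<close> is taken there, at finitely many sites, and
  only then is \<open>F\<close> released.\<close>

private lemma neumann_ell2:
  assumes "f \<in> ell2"
  shows "neumann W z f \<in> ell2"
    and "ell2_norm (neumann W z f) \<le> 1 / (cmod z - (2 + w)) * ell2_norm f"
proof -
  let ?s = "\<lambda>J n. \<Sum>j<J. (H ^^ j) f n / z ^ Suc j"
  have "L2_set (\<lambda>n. cmod (neumann W z f n)) F \<le> 1 / (cmod z - (2 + w)) * ell2_norm f"
    if F: "finite F" for F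
  proof (rule LIMSEQ_le_const2)
    have "(\<lambda>J. cmod (?s J n)) \<longlonglongrightarrow> cmod (neumann W z f n)" for n
      using tendsto_norm[OF neumann_sums[OF assms, of n, unfolded sums_def]] by simp
    then show "(\<lambda>J. L2_set (\<lambda>n. cmod (?s J n)) F) \<longlonglongrightarrow> L2_set (\<lambda>n. cmod (neumann W z f n)) F"
      unfolding L2_set_def by (intro tendsto_real_sqrt tendsto_sum tendsto_power)
    have "L2_set (\<lambda>n. cmod (?s J n)) F \<le> (\<Sum>j<J. ell2_norm f / cmod z * ((2 + w) / cmod z) ^ j)" for J
    proof (induction J)
      case 0 then show ?case by (simp add: L2_set_def)
    next
      case (Suc J)
      have "L2_set (\<lambda>n. cmod (?s (Suc J) n)) F
          \<le> L2_set (\<lambda>n. cmod (?s J n) + cmod ((H ^^ J) f n / z ^ Suc J)) F"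
        by (intro L2_set_mono) (simp_all add: norm_triangle_ineq del: power_Suc)
      also have "\<dots> \<le> L2_set (\<lambda>n. cmod (?s J n)) F + L2_set (\<lambda>n. cmod ((H ^^ J) f n / z ^ Suc J)) F"
        by (rule L2_set_triangle_ineq)
      also have "\<dots> \<le> (\<Sum>j<Suc J. ell2_norm f / cmod z * ((2 + w) / cmod z) ^ j)"
        using Suc term_bound[OF assms F, of J] by simp
      finally show ?case .
    qed
    also have "(\<Sum>j<J. ell2_norm f / cmod z * ((2 + w) / cmod z) ^ j)
        \<le> (\<Sum>j. ell2_norm f / cmod z * ((2 + w) / cmod z) ^ j)" for J
      using ratio z0 ell2_L2_set_le[OF assms, of "{}"]
      by (intro sum_le_suminf summable_mult summable_geometric) auto
    also have "\<dots> = ell2_norm f / cmod z * (1 / (1 - (2 + w) / cmod z))"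
      using ratio by (subst suminf_mult) (simp_all only: summable_geometric suminf_geometric)
    also have "\<dots> = 1 / (cmod z - (2 + w)) * ell2_norm f"
      using z z0 by (simp add: field_simps)
    finally show "\<exists>N. \<forall>J\<ge>N. L2_set (\<lambda>n. cmod (?s J n)) F \<le> 1 / (cmod z - (2 + w)) * ell2_norm f"
      by blast
  qed
  then show "neumann W z f \<in> ell2"
    "ell2_norm (neumann W z f) \<le> 1 / (cmod z - (2 + w)) * ell2_norm f"
    by (blast intro: ell2I)+
qed

private lemma ell2_lincomb:
  assumes "u \<in> ell2" "v \<in> ell2"
  shows "(\<lambda>n. c * u n + d * v n) \<in> ell2"
proof (rule ell2I(1))
  fix F :: "int set" assume F: "finite F"
  have "L2_set (\<lambda>n. cmod (c * u n + d * v n)) F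
      \<le> L2_set (\<lambda>n. cmod c * cmod (u n) + cmod d * cmod (v n)) F"
    by (intro L2_set_mono) (auto simp flip: norm_mult intro: norm_triangle_ineq)
  also have "\<dots> \<le> L2_set (\<lambda>n. cmod c * cmod (u n)) F + L2_set (\<lambda>n. cmod d * cmod (v n)) F"
    by (rule L2_set_triangle_ineq)
  also have "\<dots> \<le> cmod c * ell2_norm u + cmod d * ell2_norm v"
    using assms F
    by (simp flip: L2_set_right_distrib) (intro add_mono mult_left_mono ell2_L2_set_le, auto)
  finally show "L2_set (\<lambda>n. cmod (c * u n + d * v n)) F \<le> cmod c * ell2_norm u + cmod d * ell2_norm v" .
qed

private lemma neumann_lincomb:
  assumes "u \<in> ell2" "v \<in> ell2"
  shows "neumann W z (\<lambda>n. c * u n + d * v n) = (\<lambda>n. c * neumann W z u n + d * neumann W z v n)"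
proof
  fix n
  have "(\<lambda>j. (H ^^ j) (\<lambda>n. c * u n + d * v n) n / z ^ Suc j)
      sums (c * - neumann W z u n + d * - neumann W z v n)"
    using sums_add[OF sums_mult[OF neumann_sums[OF assms(1), of n], of c]
        sums_mult[OF neumann_sums[OF assms(2), of n], of d]]
    by (simp add: schroedinger_funpow_lincomb add_divide_distrib del: power_Suc)
  from sums_unique2[OF this neumann_sums[OF ell2_lincomb[OF assms, where c = c and d = d], of n]]
  show "neumann W z (\<lambda>n. c * u n + d * v n) n = c * neumann W z u n + d * neumann W z v n"
    by (simp add: algebra_simps)
qed

text \<open>Each term is the difference of consecutive members of
  \<open>(H ^^ j) f n / z ^ j\<close>, which starts at \<open>f n\<close> and tends to 0. Both
  inverse identities for the resolvent reduce to this series.\<close>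

private lemma neumann_telescope:
  assumes "f \<in> ell2"
  shows "(\<lambda>j. ((H ^^ Suc j) f n - z * (H ^^ j) f n) / z ^ Suc j) sums (- f n)"
proof -
  \<comment> \<open>The terms of the convergent Neumann series vanish in the limit; the factor
    \<open>z\<close> lowers the exponent from \<open>Suc j\<close> to \<open>j\<close>.\<close>
  have "(\<lambda>j. z * ((H ^^ j) f n / z ^ Suc j)) \<longlonglongrightarrow> z * 0"
    by (intro tendsto_mult_left summable_LIMSEQ_zero sums_summable[OF neumann_sums] assms)
  then have "(\<lambda>j. (H ^^ j) f n / z ^ j) \<longlonglongrightarrow> 0"
    using z0 by simp
  from telescope_sums[OF this] show ?thesis
    using z0 by (simp add: diff_divide_distrib)
qed

lemma outside_radius_in_resolvent_set: "z \<in> resolvent_set (schroedinger W)"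
  unfolding resolvent_set_def mem_Collect_eq
proof (intro exI[of _ "neumann W z"] conjI ballI)
  show "bounded_operator_on_ell2 (neumann W z)"
    unfolding bounded_operator_on_ell2_def
  proof (intro conjI ballI allI)
    fix u v c assume u: "u \<in> ell2"
    show "neumann W z u \<in> ell2" by (rule neumann_ell2[OF u])
    show "neumann W z (\<lambda>n. c * u n) = (\<lambda>n. c * neumann W z u n)"
      using neumann_lincomb[OF u u, where c = c and d = 0] by simp
    assume v: "v \<in> ell2"
    show "neumann W z (\<lambda>n. u n + v n) = (\<lambda>n. neumann W z u n + neumann W z v n)"
      using neumann_lincomb[OF u v, where c = 1 and d = 1] by simp
  qed (use neumann_ell2 in blast)
next
  fix u assume u: "u \<in> ell2"
  have "(H ^^ j) (\<lambda>n. H u n - z * u n) n = (H ^^ Suc j) u n - z * (H ^^ j) u n" for j n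
    using schroedinger_funpow_lincomb[where j = j and W = W and c = 1 and d = "- z" and u = "H u" and v = u]
    by (simp add: funpow_swap1)
  moreover have "(\<lambda>n. H u n - z * u n) \<in> ell2"
    using ell2_lincomb[OF schroedinger_ell2(1)[OF W u] u, where c = 1 and d = "- z"] by simp
  ultimately have "(\<lambda>j. ((H ^^ Suc j) u n - z * (H ^^ j) u n) / z ^ Suc j)
      sums (- neumann W z (\<lambda>n. H u n - z * u n) n)" for n
    using neumann_sums[of "\<lambda>n. H u n - z * u n" n] by (simp del: power_Suc funpow.simps)
  from sums_unique2[OF this neumann_telescope[OF u]]
  show "neumann W z (\<lambda>n. H u n - z * u n) = u" by auto
  show "(\<lambda>n. H (neumann W z u) n - z * neumann W z u n) = u"
  proof
    fix n
    let ?r = "\<lambda>j. (H ^^ j) u" and ?N = "neumann W z u"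
    \<comment> \<open>At a given site \<open>H\<close> involves only three values, so it may be
      applied to the series term by term.\<close>
    have "(\<lambda>j. (?r j (n + 1) / z ^ Suc j + ?r j (n - 1) / z ^ Suc j
          + complex_of_real (W n) * (?r j n / z ^ Suc j)) - z * (?r j n / z ^ Suc j))
        sums ((- ?N (n + 1) + - ?N (n - 1) + complex_of_real (W n) * - ?N n) - z * - ?N n)"
      by (intro sums_add sums_diff sums_mult neumann_sums u)
    then have "(\<lambda>j. ((H ^^ Suc j) u n - z * (H ^^ j) u n) / z ^ Suc j)
        sums (- (H ?N n - z * ?N n))"
      by (simp add: schroedinger_def diff_divide_distrib add_divide_distrib algebra_simps
          del: power_Suc)
    from sums_unique2[OF this neumann_telescope[OF u]] show "H ?N n - z * ?N n = u n"
      by (simp add: algebra_simps)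
  qed
qed

end

lemma spectrum_schroedinger_bound:
  assumes "\<And>n. \<bar>W n\<bar> \<le> w" and "z \<in> spectrum (schroedinger W)"
  shows "cmod z \<le> 2 + w"
  using outside_radius_in_resolvent_set[OF assms(1), of z] assms(2)
  by (fastforce simp: spectrum_def)

section \<open>Gram matrices of two by two matrices\<close>

lemma norm_matrix_sq:
  fixes A :: "real^'n^'m"
  shows "(norm A)\<^sup>2 = (\<Sum>i\<in>UNIV. \<Sum>j\<in>UNIV. (A $ i $ j)\<^sup>2)"
  by (simp add: norm_vec_def L2_set_def sum_nonneg)

lemma norm_transpose: "norm (transpose A) = norm A" for A :: "real^'n^'m"
proof -
  have "(norm (transpose A))\<^sup>2 = (norm A)\<^sup>2"
    unfolding norm_matrix_sq transpose_def by (subst sum.swap) simp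
  then show ?thesis by simp
qed

text \<open>Cauchy-Schwarz in every row.\<close>

lemma norm_matrix_vector_mult_le: "norm (A *v x) \<le> norm A * norm x" for A :: "real^'n^'m"
proof (rule power2_le_imp_le)
  have "(norm (A *v x))\<^sup>2 = (\<Sum>i\<in>UNIV. (A $ i \<bullet> x)\<^sup>2)"
    by (simp add: norm_vec_def L2_set_def sum_nonneg matrix_vector_mult_def inner_vec_def)
  also have "\<dots> \<le> (\<Sum>i\<in>UNIV. (norm (A $ i))\<^sup>2 * (norm x)\<^sup>2)"
    by (intro sum_mono) (metis Cauchy_Schwarz_ineq2 abs_ge_zero power2_abs power_mono power_mult_distrib)
  also have "\<dots> = (norm A * norm x)\<^sup>2"
    by (simp add: power_mult_distrib sum_distrib_right norm_vec_def[of A] L2_set_def sum_nonneg)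
  finally show "(norm (A *v x))\<^sup>2 \<le> (norm A * norm x)\<^sup>2" .
qed simp

text \<open>The rows of \<open>A ** B\<close> are the images of the rows of \<open>A\<close> under
  \<open>transpose B\<close>, so the bound for vectors applies row by row.\<close>

lemma norm_matrix_mult_le: "norm (A ** B) \<le> norm A * norm B"
  for A :: "real^'n^'m" and B :: "real^'k^'n"
proof (rule power2_le_imp_le)
  have row: "(A ** B) $ i = transpose B *v (A $ i)" for i
    by (simp add: vec_eq_iff matrix_matrix_mult_def matrix_vector_mult_def transpose_def mult.commute)
  have "(norm (A ** B))\<^sup>2 = (\<Sum>i\<in>UNIV. (norm (transpose B *v (A $ i)))\<^sup>2)"
    by (simp add: norm_vec_def[of "A ** B"] L2_set_def sum_nonneg row)
  also have "\<dots> \<le> (\<Sum>i\<in>UNIV. (norm (A $ i))\<^sup>2 * (norm B)\<^sup>2)"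
    by (intro sum_mono)
       (metis norm_matrix_vector_mult_le norm_transpose norm_ge_zero power_mono power_mult_distrib
          mult.commute)
  also have "\<dots> = (norm A * norm B)\<^sup>2"
    by (simp add: power_mult_distrib sum_distrib_right norm_vec_def[of A] L2_set_def sum_nonneg)
  finally show "(norm (A ** B))\<^sup>2 \<le> (norm A * norm B)\<^sup>2" .
qed simp

text \<open>The norm of the matrix type is Euclidean in all entries; the estimates are made with
  \<open>norm\<close> and translated in the final theorem.\<close>

lemma frobenius_norm_eq_norm: "frobenius_norm A = norm A"
proof -
  have "trace (A ** transpose A) = (norm A)\<^sup>2"
    unfolding norm_matrix_sq
    by (simp add: trace_def matrix_matrix_mult_def transpose_def power2_eq_square)
  then show ?thesis by (simp add: frobenius_norm_def)
qed

section \<open>Adjugates as inverses of unimodular matrices\<close>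

definition adjugate :: "real^2^2 \<Rightarrow> real^2^2" where
  "adjugate A = vector [vector [A $ 2 $ 2, - A $ 1 $ 2], vector [- A $ 2 $ 1, A $ 1 $ 1]]"

lemma adjugate_mult: "adjugate (A ** B) = adjugate B ** adjugate A"
  by (simp add: adjugate_def vec_eq_iff matrix_matrix_mult_def sum_2 forall_2)

text \<open>Linearity is special to size two; it makes the distance of two inverses equal to the
  distance of the matrices when both have determinant 1.\<close>

lemma adjugate_diff: "adjugate (A - B) = adjugate A - adjugate B"
  by (simp add: adjugate_def vec_eq_iff forall_2)

lemma norm_adjugate: "norm (adjugate A) = norm A"
proof -
  have "(norm (adjugate A))\<^sup>2 = (norm A)\<^sup>2"
    unfolding norm_matrix_sq by (simp add: sum_2 adjugate_def)
  then show ?thesis by simp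
qed

lemma det_adjugate: "det (adjugate A) = det A"
  by (simp add: adjugate_def det_2)

lemma adjugate_inverse:
  assumes "det A = 1"
  shows "adjugate A ** A = mat 1" "A ** adjugate A = mat 1"
  using assms
  by (simp_all add: adjugate_def vec_eq_iff matrix_matrix_mult_def sum_2 forall_2 det_2 mat_def
      algebra_simps)

text \<open>The inverse is the adjugate, which has the same norm as \<open>A\<close>.\<close>

lemma norm_le_of_det_1:
  fixes A :: "real^2^2"
  assumes "det A = 1"
  shows "norm v \<le> norm A * norm (A *v v)"
proof -
  have "v = adjugate A *v (A *v v)"
    by (simp add: matrix_vector_mul_assoc adjugate_inverse[OF assms])
  then show ?thesis
    by (metis norm_matrix_vector_mult_le norm_adjugate)
qed

text \<open>The squared norm exceeds twice the determinant by
  \<open>(A$1$1 - A$2$2)^2 + (A$1$2 + A$2$1)^2\<close>.\<close>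

lemma norm_ge_1_of_det_1:
  fixes A :: "real^2^2"
  assumes "det A = 1"
  shows "1 \<le> norm A"
proof -
  have "2 * (A$1$1 * A$2$2 - A$1$2 * A$2$1) \<le> (norm A)\<^sup>2"
    unfolding norm_matrix_sq
    using sum_squares_ge_zero[of "A$1$1 - A$2$2" "A$1$2 + A$2$1"]
    by (simp add: sum_2 power2_eq_square algebra_simps)
  then have "1\<^sup>2 \<le> (norm A)\<^sup>2" using assms by (simp add: det_2)
  then show ?thesis by (rule power2_le_imp_le) simp
qed

section \<open>Semidefinite forms and monotonicity of the determinant\<close>

lemma binary_form_nonneg_discriminant:
  fixes p q r :: real
  assumes "\<And>x y. 0 \<le> p * x\<^sup>2 + 2 * q * x * y + r * y\<^sup>2"
  shows "0 \<le> p" "0 \<le> r" "q\<^sup>2 \<le> p * r"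
proof -
  show p: "0 \<le> p" and r: "0 \<le> r" using assms[of 1 0] assms[of 0 1] by auto
  \<comment> \<open>The first two test vectors produce the discriminant times \<open>p\<close> or
    \<open>r\<close>; the third settles the degenerate case \<open>p = r = 0\<close> by forcing
    \<open>q = 0\<close>.\<close>
  have pd: "0 \<le> p * (p * r - q\<^sup>2)" and rd: "0 \<le> r * (p * r - q\<^sup>2)" and q: "0 \<le> p - 2 * q\<^sup>2 + r * q\<^sup>2"
    using assms[of "- q" p] assms[of r "- q"] assms[of 1 "- q"]
    by (simp_all add: power2_eq_square algebra_simps)
  show "q\<^sup>2 \<le> p * r"
  proof (cases "p = 0 \<and> r = 0")
    case False
    then show ?thesis using pd rd p r by (auto simp: zero_le_mult_iff)
  qed (use q in auto)
qed

lemma inner_matrix_vector_2: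
  fixes A :: "real^2^2"
  assumes "transpose A = A"
  shows "vector [x, y] \<bullet> (A *v vector [x, y])
    = A $ 1 $ 1 * x\<^sup>2 + 2 * A $ 1 $ 2 * x * y + A $ 2 $ 2 * y\<^sup>2"
proof -
  have "A $ 2 $ 1 = A $ 1 $ 2"
    using arg_cong[OF assms, of "\<lambda>M. M $ 1 $ 2"] by (simp add: transpose_def)
  then show ?thesis
    by (simp add: inner_vec_def matrix_vector_mult_def sum_2 power2_eq_square algebra_simps)
qed

text \<open>With \<open>N = B - A\<close>, which is semidefinite, \<open>det B\<close> is
  \<open>det A + det N\<close> plus the mixed term \<open>p * r' + r * p' - 2 * q * q'\<close>, and
  all that is added to \<open>det A\<close> is nonnegative.\<close>

lemma det_mono_2x2:
  fixes A B :: "real^2^2"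
  assumes sym: "transpose A = A" "transpose B = B"
    and A: "\<And>v. 0 \<le> v \<bullet> (A *v v)" and AB: "\<And>v. v \<bullet> (A *v v) \<le> v \<bullet> (B *v v)"
  shows "det A \<le> det B"
proof -
  define p q r where "p = A $ 1 $ 1" and "q = A $ 1 $ 2" and "r = A $ 2 $ 2"
  define p' q' r' where "p' = B $ 1 $ 1 - p" and "q' = B $ 1 $ 2 - q" and "r' = B $ 2 $ 2 - r"
  have "0 \<le> p * x\<^sup>2 + 2 * q * x * y + r * y\<^sup>2" for x y
    using A[of "vector [x, y]"] unfolding inner_matrix_vector_2[OF sym(1)] p_def q_def r_def .
  then have A_pos: "0 \<le> p" "0 \<le> r" "q\<^sup>2 \<le> p * r"
    by (rule binary_form_nonneg_discriminant)+
  have "0 \<le> p' * x\<^sup>2 + 2 * q' * x * y + r' * y\<^sup>2" for x y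
    using AB[of "vector [x, y]"]
    unfolding inner_matrix_vector_2[OF sym(1)] inner_matrix_vector_2[OF sym(2)]
    by (simp add: p'_def q'_def r'_def p_def q_def r_def algebra_simps)
  then have N_pos: "0 \<le> p'" "0 \<le> r'" "q'\<^sup>2 \<le> p' * r'"
    by (rule binary_form_nonneg_discriminant)+
  \<comment> \<open>The mixed term is nonnegative: multiply the two discriminant bounds, then use
    the arithmetic-geometric mean inequality for \<open>p * r'\<close> and
    \<open>r * p'\<close>.\<close>
  have "(2 * q * q')\<^sup>2 \<le> 4 * (p * r * (p' * r'))"
    using mult_mono[OF A_pos(3) N_pos(3)] A_pos by (simp add: power_mult_distrib)
  also have "\<dots> \<le> (p * r' + r * p')\<^sup>2"
    using zero_le_power2[of "p * r' - r * p'"] by (simp add: power2_eq_square algebra_simps)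
  finally have "2 * q * q' \<le> p * r' + r * p'"
    by (rule power2_le_imp_le) (use A_pos N_pos in simp)
  then have "p * r - q\<^sup>2 \<le> (p + p') * (r + r') - (q + q')\<^sup>2"
    using N_pos(3) by (simp add: power2_eq_square algebra_simps)
  moreover have "A $ 2 $ 1 = q" "B $ 2 $ 1 = q + q'"
    using arg_cong[OF sym(1), of "\<lambda>M. M $ 1 $ 2"] arg_cong[OF sym(2), of "\<lambda>M. M $ 1 $ 2"]
    by (simp_all add: transpose_def q_def q'_def)
  ultimately show ?thesis
    by (simp add: det_2 p_def q_def r_def p'_def q'_def r'_def power2_eq_square)
qed

text \<open>Generalizes \<open>P_matrix\<close> to any family, so that one perturbation estimate
  serves both directions, with \<open>S\<close> and \<open>T\<close> exchanged.\<close>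

definition gram :: "('i \<Rightarrow> real^2^2) \<Rightarrow> 'i set \<Rightarrow> real^2^2" where
  "gram T I = (\<Sum>i\<in>I. transpose (T i) ** T i)"

lemma sum_matrix_vector_mult: "(\<Sum>i\<in>I. A i) *v v = (\<Sum>i\<in>I. A i *v v)" for v :: "real^'n"
  by (induction I rule: infinite_finite_induct) (simp_all add: matrix_vector_mult_add_rdistrib)

lemma inner_gram: "v \<bullet> (gram T I *v v) = (\<Sum>i\<in>I. (norm (T i *v v))\<^sup>2)"
proof -
  have "v \<bullet> ((transpose A ** A) *v v) = (norm (A *v v))\<^sup>2" for A :: "real^2^2"
    by (metis dot_lmul_matrix inner_commute matrix_vector_mul_assoc power2_norm_eq_inner
        transpose_matrix_vector)
  then show ?thesis by (simp add: gram_def sum_matrix_vector_mult inner_sum_right)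
qed

lemma transpose_gram: "transpose (gram T I) = gram T I"
proof -
  have tsum: "transpose (\<Sum>i\<in>I. A i) = (\<Sum>i\<in>I. transpose (A i))" for A :: "'a \<Rightarrow> real^2^2"
    by (simp add: vec_eq_iff transpose_def)
  show ?thesis by (simp add: gram_def tsum matrix_transpose_mul)
qed

lemma matrix_add_mult_distrib: "(A + B) ** C = A ** C + B ** C"
  for A B :: "real^'n^'m" and C :: "real^'k^'n"
  by (simp add: vec_eq_iff matrix_matrix_mult_def distrib_right sum.distrib)

text \<open>A common right factor acts by congruence, so the determinant does not change when
  \<open>det X = 1\<close>.\<close>

lemma gram_mult_right: "gram (\<lambda>i. T i ** X) I = transpose X ** gram T I ** X"
  unfolding gram_def
  by (induction I rule: infinite_finite_induct)
     (simp_all add: matrix_transpose_mul matrix_add_ldistrib matrix_add_mult_distrib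
        matrix_mul_assoc)

lemma norm_gram_le: "norm (gram T I) \<le> (\<Sum>i\<in>I. (norm (T i))\<^sup>2)"
  unfolding gram_def
  by (intro sum_norm_le) (metis norm_matrix_mult_le norm_transpose power2_eq_square)

text \<open>The sum is the trace of the Gram matrix, which has two diagonal entries. With
  \<open>norm_gram_le\<close> this makes trace and norm comparable.\<close>

lemma sum_norm_le_norm_gram: "(\<Sum>i\<in>I. (norm (T i))\<^sup>2) \<le> 2 * norm (gram T I)"
proof -
  have "(\<Sum>i\<in>I. (norm (T i))\<^sup>2) = gram T I $ 1 $ 1 + gram T I $ 2 $ 2"
    unfolding gram_def norm_matrix_sq
    by (simp add: sum_2 matrix_matrix_mult_def transpose_def power2_eq_square sum.distrib)
  also have "\<dots> \<le> norm (gram T I) + norm (gram T I)"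
    using component_le_norm_cart[of "gram T I $ 1" 1] Finite_Cartesian_Product.norm_nth_le[of "gram T I" 1]
      component_le_norm_cart[of "gram T I $ 2" 2] Finite_Cartesian_Product.norm_nth_le[of "gram T I" 2] by linarith
  finally show ?thesis by simp
qed

section \<open>Gram matrices of a perturbed family\<close>

lemma norm_sq_le_of_diff:
  fixes x y :: "'a::real_normed_vector"
  shows "(norm x)\<^sup>2 \<le> 2 * (norm y)\<^sup>2 + 2 * (norm (x - y))\<^sup>2"
proof -
  have "(norm x)\<^sup>2 \<le> (norm y + norm (x - y))\<^sup>2"
    by (intro power_mono) (use norm_triangle_sub[of x y] in auto)
  then show ?thesis
    using zero_le_power2[of "norm y - norm (x - y)"] by (simp add: power2_eq_square algebra_simps)
qed

context
  fixes S T :: "'i \<Rightarrow> real^2^2" and X :: "real^2^2" and I :: "'i set" and i0 :: 'i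
    and d :: "'i \<Rightarrow> real" and D K L :: real
  assumes I: "finite I" "i0 \<in> I" and T: "det (T i0) = 1" "norm (T i0) \<le> L"
    and X: "det X = 1" "norm X \<le> K"
    and diff: "\<And>i. i \<in> I \<Longrightarrow> norm (S i - T i ** X) \<le> d i" and D: "(\<Sum>i\<in>I. (d i)\<^sup>2) \<le> D"
begin

text \<open>The comparison is made between traces. One factor 2 comes from splitting the square of a
  sum, the other from returning from the trace to the norm.\<close>

lemma gram_perturb_norm: "norm (gram S I) \<le> 4 * (K\<^sup>2 + D) * norm (gram T I)"
proof -
  have le: "(norm (S i))\<^sup>2 \<le> 2 * (K\<^sup>2 * (norm (T i))\<^sup>2) + 2 * (d i)\<^sup>2" if "i \<in> I" for i
  proof -
    have "norm (T i ** X) \<le> K * norm (T i)"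
      using norm_matrix_mult_le[of "T i" X] mult_left_mono[OF X(2), of "norm (T i)"]
      by (simp add: mult.commute)
    then have "(norm (T i ** X))\<^sup>2 \<le> K\<^sup>2 * (norm (T i))\<^sup>2"
      by (metis norm_ge_zero power_mono power_mult_distrib)
    moreover have "(norm (S i - T i ** X))\<^sup>2 \<le> (d i)\<^sup>2"
      using diff[OF that] by (intro power_mono) auto
    ultimately show ?thesis using norm_sq_le_of_diff[of "S i" "T i ** X"] by linarith
  qed
  let ?t = "\<Sum>i\<in>I. (norm (T i))\<^sup>2"
  \<comment> \<open>The unimodular summand \<open>i0\<close> keeps the trace at least 1, so the
    additive error \<open>D\<close> is absorbed into a multiple of it.\<close>
  have "(norm (T i0))\<^sup>2 \<le> ?t" using I by (intro member_le_sum) auto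
  then have t: "1 \<le> ?t"
    using norm_ge_1_of_det_1[OF T(1)] by (smt (verit) one_le_power)
  have D0: "0 \<le> D" using D by (smt (verit) sum_nonneg zero_le_power2)
  have "norm (gram S I) \<le> (\<Sum>i\<in>I. (norm (S i))\<^sup>2)" by (rule norm_gram_le)
  also have "\<dots> \<le> (\<Sum>i\<in>I. 2 * (K\<^sup>2 * (norm (T i))\<^sup>2) + 2 * (d i)\<^sup>2)"
    by (rule sum_mono[OF le])
  also have "\<dots> = 2 * (K\<^sup>2 * ?t) + 2 * (\<Sum>i\<in>I. (d i)\<^sup>2)"
    by (simp add: sum.distrib sum_distrib_left)
  also have "\<dots> \<le> 2 * (K\<^sup>2 * ?t) + 2 * (D * ?t)"
    using D mult_left_mono[OF t D0] by simp
  also have "\<dots> = 2 * (K\<^sup>2 + D) * ?t" by (simp add: algebra_simps)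
  also have "\<dots> \<le> 2 * (K\<^sup>2 + D) * (2 * norm (gram T I))"
    using D0 by (intro mult_left_mono sum_norm_le_norm_gram) auto
  finally show ?thesis by (simp add: algebra_simps)
qed

text \<open>The error terms contribute at most a multiple of \<open>(norm v)\<^sup>2\<close>, and the single summand \<open>i0\<close>
  already dominates \<open>(norm v)\<^sup>2\<close>; this is what keeps the smaller eigenvalue under control.\<close>

lemma gram_perturb_form:
  "v \<bullet> (gram S I *v v) \<le> (2 + 2 * D * (K * L)\<^sup>2) * (v \<bullet> (gram (\<lambda>i. T i ** X) I *v v))"
proof -
  let ?t = "\<Sum>i\<in>I. (norm ((T i ** X) *v v))\<^sup>2"
  have KL: "0 \<le> K" "0 \<le> L" using X(2) T(2) norm_ge_zero order_trans by blast+
  have D0: "0 \<le> D" using D by (smt (verit) sum_nonneg zero_le_power2)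
  have "norm v \<le> norm (T i0 ** X) * norm ((T i0 ** X) *v v)"
    by (rule norm_le_of_det_1) (simp add: det_mul T X)
  also have "\<dots> \<le> (K * L) * norm ((T i0 ** X) *v v)"
  proof (intro mult_right_mono)
    show "norm (T i0 ** X) \<le> K * L"
      using norm_matrix_mult_le[of "T i0" X] mult_mono[OF T(2) X(2)] KL
      by (simp add: mult.commute)
  qed simp
  finally have "(norm v)\<^sup>2 \<le> (K * L)\<^sup>2 * (norm ((T i0 ** X) *v v))\<^sup>2"
    by (metis norm_ge_zero power_mono power_mult_distrib)
  also have "\<dots> \<le> (K * L)\<^sup>2 * ?t"
    using I by (intro mult_left_mono member_le_sum) auto
  finally have v: "(norm v)\<^sup>2 \<le> (K * L)\<^sup>2 * ?t" .
  have le: "(norm (S i *v v))\<^sup>2 \<le> 2 * (norm ((T i ** X) *v v))\<^sup>2 + 2 * ((d i)\<^sup>2 * (norm v)\<^sup>2)"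
    if "i \<in> I" for i
  proof -
    have "norm ((S i - T i ** X) *v v) \<le> d i * norm v"
      using norm_matrix_vector_mult_le[of "S i - T i ** X" v]
        mult_right_mono[OF diff[OF that], of "norm v"] by simp
    then have "(norm (S i *v v - (T i ** X) *v v))\<^sup>2 \<le> (d i)\<^sup>2 * (norm v)\<^sup>2"
      by (metis matrix_vector_mult_diff_rdistrib norm_ge_zero power_mono power_mult_distrib)
    then show ?thesis using norm_sq_le_of_diff[of "S i *v v" "(T i ** X) *v v"] by linarith
  qed
  have "(\<Sum>i\<in>I. (norm (S i *v v))\<^sup>2)
      \<le> (\<Sum>i\<in>I. 2 * (norm ((T i ** X) *v v))\<^sup>2 + 2 * ((d i)\<^sup>2 * (norm v)\<^sup>2))"
    by (rule sum_mono[OF le])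
  also have "\<dots> = 2 * ?t + 2 * ((\<Sum>i\<in>I. (d i)\<^sup>2) * (norm v)\<^sup>2)"
    by (simp add: sum.distrib sum_distrib_left sum_distrib_right)
  also have "\<dots> \<le> 2 * ?t + 2 * (D * ((K * L)\<^sup>2 * ?t))"
    using D D0 v by (intro add_mono mult_left_mono mult_mono) auto
  finally show ?thesis unfolding inner_gram by (simp add: algebra_simps)
qed

text \<open>The inequality of forms passes to determinants by monotonicity; the constant is squared
  because the size is two, and \<open>X\<close> disappears by congruence.\<close>

lemma gram_perturb_det: "det (gram S I) \<le> (2 + 2 * D * (K * L)\<^sup>2)\<^sup>2 * det (gram T I)"
proof -
  define C where "C = 2 + 2 * D * (K * L)\<^sup>2"
  let ?B = "C *\<^sub>R gram (\<lambda>i. T i ** X) I"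
  have "det (gram S I) \<le> det ?B"
  proof (rule det_mono_2x2)
    show "transpose (gram S I) = gram S I" by (rule transpose_gram)
    show "transpose ?B = ?B"
      using transpose_gram[of "\<lambda>i. T i ** X" I] by (simp add: transpose_scalar)
    show "0 \<le> v \<bullet> (gram S I *v v)" for v by (simp add: inner_gram sum_nonneg)
    show "v \<bullet> (gram S I *v v) \<le> v \<bullet> (?B *v v)" for v
      using gram_perturb_form[of v] by (simp add: C_def scaleR_matrix_vector_assoc[symmetric])
  qed
  also have "det ?B = C\<^sup>2 * det (gram (\<lambda>i. T i ** X) I)"
    by (simp add: det_2 power2_eq_square algebra_simps)
  also have "det (gram (\<lambda>i. T i ** X) I) = det (gram T I)"
    by (simp add: gram_mult_right det_mul X)
  finally show ?thesis by (simp add: C_def)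
qed

end

section \<open>Perturbation of transfer matrices\<close>

lemma P_matrix_eq_gram: "P_matrix W E k = gram (\<lambda>n. transfer_matrix W E (2 * n - 1)) {1..k}"
  by (simp add: P_matrix_def gram_def)

lemma det_transfer_step: "det (transfer_step W E n) = 1"
  by (simp add: transfer_step_def det_2)

lemma det_transfer_matrix: "det (transfer_matrix W E n) = 1"
  by (induction n) (simp_all add: det_mul det_transfer_step)

lemma norm_mat_1_le_2: "norm (mat 1 :: real^2^2) \<le> 2"
proof (rule power2_le_imp_le)
  show "(norm (mat 1 :: real^2^2))\<^sup>2 \<le> 2\<^sup>2"
    unfolding norm_matrix_sq by (simp add: sum_2 mat_def)
qed simp

lemma norm_transfer_step_le:
  assumes "\<bar>E - W n\<bar> \<le> M" "1 \<le> M"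
  shows "norm (transfer_step W E n) \<le> M + 1"
proof (rule power2_le_imp_le)
  have "(norm (transfer_step W E n))\<^sup>2 = (E - W n)\<^sup>2 + 2"
    unfolding norm_matrix_sq by (simp add: sum_2 transfer_step_def)
  also have "\<dots> \<le> M\<^sup>2 + 2"
    using power_mono[OF assms(1), of 2] by simp
  also have "\<dots> \<le> (M + 1)\<^sup>2" using assms(2) by (simp add: power2_eq_square algebra_simps)
  finally show "(norm (transfer_step W E n))\<^sup>2 \<le> (M + 1)\<^sup>2" .
qed (use assms in simp)

lemma norm_transfer_matrix_le:
  assumes "\<And>n. \<bar>E - W n\<bar> \<le> M" "1 \<le> M"
  shows "norm (transfer_matrix W E n) \<le> 2 * (M + 1) ^ n"
proof (induction n)
  case (Suc n)
  have "norm (transfer_matrix W E (Suc n))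
      \<le> norm (transfer_step W E (int (Suc n))) * norm (transfer_matrix W E n)"
    by (simp add: norm_matrix_mult_le)
  also have "\<dots> \<le> (M + 1) * (2 * (M + 1) ^ n)"
    using assms(2) by (intro mult_mono norm_transfer_step_le assms Suc) auto
  finally show ?case by simp
qed (simp add: norm_mat_1_le_2)

section \<open>Variation of constants\<close>

lemma norm_transfer_step_diff: "norm (transfer_step W E n - transfer_step V E n) = \<bar>W n - V n\<bar>"
proof -
  have "(norm (transfer_step W E n - transfer_step V E n))\<^sup>2 = \<bar>W n - V n\<bar>\<^sup>2"
    unfolding norm_matrix_sq
    by (simp add: sum_2 transfer_step_def power2_commute[of "V n"])
  then show ?thesis by (rule power2_eq_imp_eq) simp_all
qed

text \<open>Each growth factor \<open>1 + x\<close> is at most \<open>exp x\<close>, so the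
  exponents add up to a geometric sum.\<close>

lemma discrete_gronwall:
  fixes r :: "nat \<Rightarrow> real"
  assumes e: "0 \<le> e" "e < 1" and g: "0 \<le> g" and r: "\<And>n. 0 \<le> r n" "r 0 \<le> r0"
    and step: "\<And>n. r (Suc n) \<le> (1 + g * e ^ n) * r n"
  shows "r n \<le> r0 * exp (g / (1 - e))"
proof -
  have r0: "0 \<le> r0" using r order_trans by blast
  have "r n \<le> r0 * exp (g * (\<Sum>i<n. e ^ i))"
  proof (induction n)
    case (Suc n)
    have "r (Suc n) \<le> (1 + g * e ^ n) * r n" by (rule step)
    also have "\<dots> \<le> exp (g * e ^ n) * (r0 * exp (g * (\<Sum>i<n. e ^ i)))"
      using e g r Suc by (intro mult_mono exp_ge_add_one_self) auto
    also have "\<dots> = r0 * exp (g * (\<Sum>i<Suc n. e ^ i))"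
      by (simp add: exp_add distrib_left)
    finally show ?case .
  qed (use r in simp)
  also have "\<dots> \<le> r0 * exp (g * (1 / (1 - e)))"
  proof -
    have "(\<Sum>i<n. e ^ i) \<le> 1 / (1 - e)"
      using e sum_le_suminf[of "\<lambda>i. e ^ i" "{..<n}"] by (simp add: suminf_geometric)
    from mult_left_mono[OF this g] show ?thesis
      using r0 by (intro mult_left_mono) simp_all
  qed
  finally show ?thesis by simp
qed

text \<open>The matrix \<open>Q n\<close> of the overview: the adjugate inverts the unperturbed
  transfer matrix, whose determinant is 1.\<close>

definition transfer_ratio :: "(int \<Rightarrow> real) \<Rightarrow> (int \<Rightarrow> real) \<Rightarrow> real \<Rightarrow> nat \<Rightarrow> real^2^2" where
  "transfer_ratio V W E n = adjugate (transfer_matrix V E n) ** transfer_matrix W E n"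

lemma det_transfer_ratio: "det (transfer_ratio V W E n) = 1"
  by (simp add: transfer_ratio_def det_mul det_adjugate det_transfer_matrix)

lemma transfer_matrix_mult_ratio:
  "transfer_matrix V E n ** transfer_ratio V W E n = transfer_matrix W E n"
  by (simp add: transfer_ratio_def matrix_mul_assoc adjugate_inverse det_transfer_matrix)

lemma transfer_matrix_mult_adjugate_ratio:
  "transfer_matrix W E n ** adjugate (transfer_ratio V W E n) = transfer_matrix V E n"
  by (simp add: adjugate_inverse det_transfer_ratio
      flip: transfer_matrix_mult_ratio[of V E n W] matrix_mul_assoc)

lemma matrix_diff_ldistrib: "A ** (B - C) = A ** B - A ** C"
  for A :: "real^'n^'m" and B C :: "real^'k^'n"
  by (simp add: vec_eq_iff matrix_matrix_mult_def right_diff_distrib sum_subtractf)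

lemma matrix_diff_rdistrib: "(A - B) ** C = A ** C - B ** C"
  for A B :: "real^'n^'m" and C :: "real^'k^'n"
  by (simp add: vec_eq_iff matrix_matrix_mult_def left_diff_distrib sum_subtractf)

text \<open>Inverting \<open>T (Suc n)\<close> and applying the unperturbed step gives the inverse
  of \<open>T n\<close>, so only the difference of the steps survives. The last factor is kept as
  \<open>T n ** Q n\<close>, so that norms give a recursion in \<open>Q\<close>.\<close>

lemma transfer_ratio_step:
  "transfer_ratio V W E (Suc n) - transfer_ratio V W E n
    = adjugate (transfer_matrix V E (Suc n))
      ** ((transfer_step W E (int (Suc n)) - transfer_step V E (int (Suc n)))
        ** (transfer_matrix V E n ** transfer_ratio V W E n))"
proof -
  let ?A = "transfer_step V E (int (Suc n))"
  have "adjugate (transfer_matrix V E (Suc n)) ** ?A = adjugate (transfer_matrix V E n)"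
    by (simp add: adjugate_mult adjugate_inverse det_transfer_step flip: matrix_mul_assoc)
  then show ?thesis
    unfolding transfer_matrix_mult_ratio matrix_diff_rdistrib matrix_diff_ldistrib
    by (simp add: transfer_ratio_def matrix_mul_assoc)
qed

text \<open>From \<open>3 <= M\<close> one has \<open>M + 1 <= 4/3 * M\<close>, and the cube of
  \<open>4/3\<close> is below 3. Two powers of \<open>M + 1\<close> arise in the step of
  \<open>Q\<close>, the third from the transfer matrix that multiplies the error.\<close>

lemma cube_ratio_less_1:
  fixes M :: real
  assumes M: "3 \<le> M"
  shows "(M + 1) ^ 3 / M ^ 4 < 1"
proof -
  have "(M + 1) ^ 3 \<le> (4 / 3 * M) ^ 3"
    using M by (intro power_mono) auto
  also have "\<dots> < 3 * M ^ 3" using M by (simp add: power_mult_distrib power_divide)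
  also have "\<dots> \<le> M * M ^ 3" using M by (intro mult_right_mono) auto
  finally show ?thesis using M by (simp add: power4_eq_xxxx power3_eq_cube)
qed

section \<open>Bounds on the ratio and on the errors\<close>

context
  fixes V W :: "int \<Rightarrow> real" and E M c \<epsilon> \<theta> K D :: real
  assumes V: "\<And>n. \<bar>E - V n\<bar> \<le> M" and M: "3 \<le> M"
    and c: "0 \<le> c" and VW: "\<And>n :: nat. 1 \<le> n \<Longrightarrow> \<bar>W (int n) - V (int n)\<bar> \<le> c * (1 / M ^ 4) ^ n"
    and \<epsilon>: "\<epsilon> = (M + 1)\<^sup>2 / M ^ 4" and \<theta>: "\<theta> = (M + 1) ^ 3 / M ^ 4"
    and K: "K = 2 * exp (4 * c / (1 - \<epsilon>))" and D: "D = 8 * c * K\<^sup>2 / (1 - \<epsilon>)"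
begin

private abbreviation "T \<equiv> transfer_matrix V E"
private abbreviation "S \<equiv> transfer_matrix W E"
private abbreviation "Q \<equiv> transfer_ratio V W E"

text \<open>Here \<epsilon> is the decay rate of the increments of \<open>Q\<close>, and \<theta>
  that of the errors \<open>T n ** (Q n - Q k)\<close>.\<close>

private lemma \<epsilon>_\<theta>: "0 < \<epsilon>" "\<epsilon> < 1" "0 < \<theta>" "\<theta> < 1" "\<theta> = (M + 1) * \<epsilon>"
proof -
  show "0 < \<epsilon>" "0 < \<theta>" using M by (auto simp: \<epsilon> \<theta>)
  show "\<theta> < 1" unfolding \<theta> by (rule cube_ratio_less_1[OF M])
  show eq: "\<theta> = (M + 1) * \<epsilon>" by (simp add: \<epsilon> \<theta> power2_eq_square power3_eq_cube)
  have "\<epsilon> \<le> (M + 1) * \<epsilon>"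
    using mult_right_mono[of 1 "M + 1" \<epsilon>] M \<open>0 < \<epsilon>\<close> by simp
  then show "\<epsilon> < 1" using \<open>\<theta> < 1\<close> eq by linarith
qed

private lemma norm_T: "norm (T n) \<le> 2 * (M + 1) ^ n"
  using V M by (intro norm_transfer_matrix_le) auto

private lemma norm_Q_step: "norm (Q (Suc n) - Q n) \<le> 4 * c * \<epsilon> ^ n * norm (Q n)"
proof -
  let ?B = "transfer_step W E (int (Suc n)) - transfer_step V E (int (Suc n))"
  have "norm (Q (Suc n) - Q n) \<le> norm (T (Suc n)) * (norm ?B * (norm (T n) * norm (Q n)))"
    unfolding transfer_ratio_step
    by (rule norm_matrix_mult_le[THEN order_trans], unfold norm_adjugate,
        intro mult_left_mono norm_ge_zero,
        rule norm_matrix_mult_le[THEN order_trans],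
        intro mult_left_mono norm_ge_zero norm_matrix_mult_le)
  also have "\<dots> \<le> (2 * (M + 1) ^ Suc n)
      * ((c * (1 / M ^ 4) ^ Suc n) * ((2 * (M + 1) ^ n) * norm (Q n)))"
    using M c VW[of "Suc n"]
    by (intro mult_mono norm_T) (auto simp: norm_transfer_step_diff simp del: power_Suc of_nat_Suc)
  \<comment> \<open>The 4 collects the constants 2 of both transfer bounds. There are
    \<open>2 * n + 1\<close> factors \<open>M + 1\<close>, one fewer than in
    \<open>\<epsilon> ^ Suc n\<close>.\<close>
  also have "\<dots> = 4 * c * norm (Q n) * (\<epsilon> ^ Suc n / (M + 1))"
  proof -
    have "\<epsilon> ^ Suc n = (M + 1) ^ Suc n * (M + 1) ^ n * (M + 1) * (1 / M ^ 4) ^ Suc n"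
      by (simp add: \<epsilon> power2_eq_square power_mult_distrib power_divide)
    then show ?thesis using M by simp
  qed
  also have "\<dots> \<le> 4 * c * norm (Q n) * \<epsilon> ^ n"
  proof (intro mult_left_mono)
    have "\<epsilon> / (M + 1) \<le> 1"
      using \<epsilon>_\<theta>(1,2) M by simp
    from mult_left_mono[OF this, of "\<epsilon> ^ n"] \<epsilon>_\<theta>(1) show "\<epsilon> ^ Suc n / (M + 1) \<le> \<epsilon> ^ n"
      by (simp add: mult.commute)
  qed (use c in simp)
  finally show ?thesis by (simp add: mult_ac)
qed

private lemma norm_Q: "norm (Q n) \<le> K"
  unfolding K
proof (rule discrete_gronwall[where g = "4 * c"])
  show "norm (Q (Suc n)) \<le> (1 + 4 * c * \<epsilon> ^ n) * norm (Q n)" for n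
    using norm_Q_step[of n] norm_triangle_sub[of "Q (Suc n)" "Q n"] by (simp add: algebra_simps)
  have "Q 0 = mat 1"
    by (simp add: transfer_ratio_def adjugate_inverse(1)[of "mat 1", simplified])
  then show "norm (Q 0) \<le> 2" by (simp add: norm_mat_1_le_2)
qed (use \<epsilon>_\<theta> c in auto)

private lemma K_ge: "1 \<le> K"
proof -
  have "0 \<le> 4 * c / (1 - \<epsilon>)" using c \<epsilon>_\<theta>(2) by simp
  then have "1 \<le> exp (4 * c / (1 - \<epsilon>))" by simp
  then show ?thesis unfolding K by linarith
qed

private lemma norm_Q_diff:
  assumes "n \<le> k"
  shows "norm (Q n - Q k) \<le> 4 * c * K * \<epsilon> ^ n / (1 - \<epsilon>)"
proof -
  \<comment> \<open>The exact geometric partial sum is kept, since with it the induction over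
    \<open>k\<close> closes.\<close>
  have "norm (Q n - Q k) \<le> 4 * c * K * (\<epsilon> ^ n - \<epsilon> ^ k) / (1 - \<epsilon>)"
    using assms
  proof (induction k rule: dec_induct)
    case (step k)
    have "norm (Q n - Q (Suc k)) \<le> norm (Q n - Q k) + norm (Q (Suc k) - Q k)"
      using norm_triangle_ineq4[of "Q n - Q k" "Q (Suc k) - Q k"] by simp
    also have "\<dots> \<le> 4 * c * K * (\<epsilon> ^ n - \<epsilon> ^ k) / (1 - \<epsilon>) + 4 * c * \<epsilon> ^ k * K"
    proof (rule add_mono[OF step.IH])
      show "norm (Q (Suc k) - Q k) \<le> 4 * c * \<epsilon> ^ k * K"
        using c \<epsilon>_\<theta>(1) by (intro norm_Q_step[THEN order_trans] mult_left_mono norm_Q) auto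
    qed
    also have "\<dots> = 4 * c * K * (\<epsilon> ^ n - \<epsilon> ^ Suc k) / (1 - \<epsilon>)"
      using \<epsilon>_\<theta>(2) by (simp add: field_simps)
    finally show ?case .
  qed simp
  also have "\<dots> \<le> 4 * c * K * \<epsilon> ^ n / (1 - \<epsilon>)"
    using \<epsilon>_\<theta>(1,2) c K_ge by (intro divide_right_mono mult_left_mono) auto
  finally show ?thesis .
qed

text \<open>The factor \<open>K\<close> is given away so that \<open>T\<close> and \<open>S\<close>
  obey the same bound and can exchange roles.\<close>

private lemma norm_T_K: "norm (T n) \<le> 2 * K * (M + 1) ^ n"
proof (rule order_trans[OF norm_T])
  show "2 * (M + 1) ^ n \<le> 2 * K * (M + 1) ^ n"
    using K_ge M by (intro mult_right_mono) auto
qed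

private lemma norm_S: "norm (S n) \<le> 2 * K * (M + 1) ^ n"
proof -
  have "norm (S n) \<le> norm (T n) * norm (Q n)"
    by (metis transfer_matrix_mult_ratio norm_matrix_mult_le)
  also have "\<dots> \<le> 2 * (M + 1) ^ n * K"
    using M by (intro mult_mono norm_T norm_Q) auto
  finally show ?thesis by (simp add: mult_ac)
qed

private lemma bound_D:
  assumes "n \<le> k" and A: "norm (A :: real^2^2) \<le> 2 * K * (M + 1) ^ n" and B: "norm B = norm (Q n - Q k)"
  shows "norm (A ** B) \<le> D * \<theta> ^ n"
proof -
  have "norm (A ** B) \<le> norm A * norm B" by (fact norm_matrix_mult_le)
  also have "\<dots> \<le> (2 * K * (M + 1) ^ n) * (4 * c * K * \<epsilon> ^ n / (1 - \<epsilon>))"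
    unfolding B using M K_ge by (intro mult_mono A norm_Q_diff assms) auto
  also have "\<dots> = D * ((M + 1) * \<epsilon>) ^ n"
    unfolding D power_mult_distrib power2_eq_square by simp
  finally show ?thesis unfolding \<epsilon>_\<theta>(5) .
qed

private lemma S_diff: "n \<le> k \<Longrightarrow> norm (S n - T n ** Q k) \<le> D * \<theta> ^ n"
proof -
  assume n: "n \<le> k"
  have "S n - T n ** Q k = T n ** (Q n - Q k)"
    by (simp add: matrix_diff_ldistrib transfer_matrix_mult_ratio)
  then show ?thesis using bound_D[OF n norm_T_K, of "Q n - Q k"] by simp
qed

text \<open>The mirror image of \<open>S_diff\<close>: \<open>T n\<close> is \<open>S n\<close>
  times the inverse of \<open>Q n\<close>, and linearity of the adjugate turns the error into
  \<open>S n ** adjugate (Q n - Q k)\<close>.\<close>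

private lemma T_diff: "n \<le> k \<Longrightarrow> norm (T n - S n ** adjugate (Q k)) \<le> D * \<theta> ^ n"
proof -
  assume n: "n \<le> k"
  have "T n - S n ** adjugate (Q k) = S n ** adjugate (Q n - Q k)"
    by (simp add: matrix_diff_ldistrib adjugate_diff transfer_matrix_mult_adjugate_ratio)
  then show ?thesis using bound_D[OF n norm_S norm_adjugate] by metis
qed

private lemma sum_errors: "(\<Sum>i=1..k. (D * \<theta> ^ (2 * i - 1))\<^sup>2) \<le> D\<^sup>2 / (1 - \<theta>)"
proof -
  have "(D * \<theta> ^ (2 * i - 1))\<^sup>2 \<le> D\<^sup>2 * \<theta> ^ i" if "i \<in> {1..k}" for i
  proof -
    have "(\<theta> ^ (2 * i - 1))\<^sup>2 = \<theta> ^ ((2 * i - 1) * 2)" by (rule power_mult[symmetric])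
    \<comment> \<open>For \<open>i\<close> at least 1 the exponent \<open>4 * i - 2\<close> is at
      least \<open>i\<close>.\<close>
    also have "\<dots> \<le> \<theta> ^ i"
      using that \<epsilon>_\<theta>(3,4) by (intro power_decreasing) auto
    finally show ?thesis
      unfolding power_mult_distrib by (intro mult_left_mono) simp_all
  qed
  then have "(\<Sum>i=1..k. (D * \<theta> ^ (2 * i - 1))\<^sup>2) \<le> (\<Sum>i=1..k. D\<^sup>2 * \<theta> ^ i)"
    by (rule sum_mono)
  also have "\<dots> = D\<^sup>2 * (\<Sum>i=1..k. \<theta> ^ i)" by (simp only: sum_distrib_left)
  also have "\<dots> \<le> D\<^sup>2 * (\<Sum>i. \<theta> ^ i)"
    using \<epsilon>_\<theta>(3,4) by (intro mult_left_mono sum_le_suminf) auto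
  also have "(\<Sum>i. \<theta> ^ i) = 1 / (1 - \<theta>)"
    using \<epsilon>_\<theta>(3,4) by (intro suminf_geometric) auto
  finally show ?thesis by simp
qed

text \<open>The distinguished summand is the first one, present for every \<open>k\<close>, so
  \<open>L\<close> bounds a transfer matrix at site 1 and does not depend on \<open>k\<close>. The
  common right factor is \<open>Q\<close> at the last site \<open>2 * k - 1\<close>, or its inverse
  for the reverse direction.\<close>

lemma P_matrix_perturb:
  assumes k: "1 \<le> k"
  defines "D' \<equiv> D\<^sup>2 / (1 - \<theta>)" and "L \<equiv> 2 * K * (M + 1)"
  shows "norm (P_matrix W E k) \<le> 4 * (K\<^sup>2 + D') * norm (P_matrix V E k)"
    and "norm (P_matrix V E k) \<le> 4 * (K\<^sup>2 + D') * norm (P_matrix W E k)"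
    and "det (P_matrix W E k) \<le> (2 + 2 * D' * (K * L)\<^sup>2)\<^sup>2 * det (P_matrix V E k)"
    and "det (P_matrix V E k) \<le> (2 + 2 * D' * (K * L)\<^sup>2)\<^sup>2 * det (P_matrix W E k)"
proof -
  let ?I = "{1..k}" and ?m = "2 * k - 1"
  have mem: "finite ?I" "1 \<in> ?I" using k by auto
  have T1: "det (T (2 * 1 - 1)) = 1" "norm (T (2 * 1 - 1)) \<le> L"
    using norm_T_K[of 1] det_transfer_matrix[of V E 1] by (simp_all add: L_def)
  have S1: "det (S (2 * 1 - 1)) = 1" "norm (S (2 * 1 - 1)) \<le> L"
    using norm_S[of 1] det_transfer_matrix[of W E 1] by (simp_all add: L_def)
  have Q1: "det (Q ?m) = 1" "norm (Q ?m) \<le> K"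
    using norm_Q[of ?m] by (simp_all only: det_transfer_ratio)
  have Q2: "det (adjugate (Q ?m)) = 1" "norm (adjugate (Q ?m)) \<le> K"
    using Q1 by (simp_all only: det_adjugate norm_adjugate)
  note sum = sum_errors[of k, folded D'_def]
  have le: "2 * i - 1 \<le> ?m" if "i \<in> ?I" for i using that by auto
  note ST = S_diff[OF le] and TS = T_diff[OF le]
  show "norm (P_matrix W E k) \<le> 4 * (K\<^sup>2 + D') * norm (P_matrix V E k)"
    unfolding P_matrix_eq_gram by (rule gram_perturb_norm[OF mem T1 Q1 ST sum])
  show "norm (P_matrix V E k) \<le> 4 * (K\<^sup>2 + D') * norm (P_matrix W E k)"
    unfolding P_matrix_eq_gram by (rule gram_perturb_norm[OF mem S1 Q2 TS sum])
  show "det (P_matrix W E k) \<le> (2 + 2 * D' * (K * L)\<^sup>2)\<^sup>2 * det (P_matrix V E k)"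
    unfolding P_matrix_eq_gram by (rule gram_perturb_det[OF mem T1 Q1 ST sum])
  show "det (P_matrix V E k) \<le> (2 + 2 * D' * (K * L)\<^sup>2)\<^sup>2 * det (P_matrix W E k)"
    unfolding P_matrix_eq_gram by (rule gram_perturb_det[OF mem S1 Q2 TS sum])
qed

end

section \<open>Universal constants and the comparison theorem\<close>

lemma P_matrix_perturb_uniform:
  fixes M c :: real
  assumes M: "3 \<le> M" and c: "0 \<le> c"
  obtains g h :: real where "0 < g" "0 < h"
    "\<And>V W E k. (\<And>n. \<bar>E - V n\<bar> \<le> M)
      \<Longrightarrow> (\<And>n :: nat. 1 \<le> n \<Longrightarrow> \<bar>W (int n) - V (int n)\<bar> \<le> c * (1 / M ^ 4) ^ n) \<Longrightarrow> 1 \<le> k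
      \<Longrightarrow> norm (P_matrix W E k) \<le> g * norm (P_matrix V E k)
        \<and> norm (P_matrix V E k) \<le> g * norm (P_matrix W E k)
        \<and> det (P_matrix W E k) \<le> h * det (P_matrix V E k)
        \<and> det (P_matrix V E k) \<le> h * det (P_matrix W E k)"
proof -
  define K where "K = 2 * exp (4 * c / (1 - (M + 1)\<^sup>2 / M ^ 4))"
  \<comment> \<open>This is \<open>D'\<close> of \<open>P_matrix_perturb\<close>, the bound on the
    sum of squared errors. Like \<open>K\<close> it depends on \<open>M\<close> and \<open>c\<close>
    alone, hence the uniformity in \<open>E\<close> and \<open>k\<close>.\<close>
  define D where "D = (8 * c * K\<^sup>2 / (1 - (M + 1)\<^sup>2 / M ^ 4))\<^sup>2 / (1 - (M + 1) ^ 3 / M ^ 4)"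
  have "0 \<le> D" "0 < K"
    using cube_ratio_less_1[OF M] by (simp_all add: D_def K_def)
  then have "0 < 4 * (K\<^sup>2 + D)" "0 < 2 + 2 * D * (K * (2 * K * (M + 1)))\<^sup>2"
    by (auto intro!: add_pos_nonneg)
  then have "0 < 4 * (K\<^sup>2 + D)" "0 < (2 + 2 * D * (K * (2 * K * (M + 1)))\<^sup>2)\<^sup>2"
    by simp_all
  then show thesis
    by (rule that)
       (use P_matrix_perturb[OF _ M c _ refl refl refl refl] in \<open>simp add: K_def D_def\<close>)
qed

lemma abs_le_sup_norm:
  assumes "bounded (range W)"
  shows "\<bar>W n\<bar> \<le> sup_norm W"
proof -
  obtain B where "\<And>n. \<bar>W n\<bar> \<le> B" using assms by (auto simp: bounded_iff)
  then have "bdd_above (range (\<lambda>n. \<bar>W n\<bar>))" by (intro bdd_aboveI2)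
  then show ?thesis unfolding sup_norm_def by (intro cSUP_upper) auto
qed

theorem theorem4p1:
  fixes V b :: "int \<Rightarrow> real" and \<eta> a \<tau> \<kappa> :: real
  assumes V_bdd: "bounded (range V)"
    and inv_lim: "\<And>E :: real. complex_of_real E \<in> spectrum (schroedinger V) \<Longrightarrow>
      (\<lambda>k. frobenius_norm (matrix_inv (P_matrix V E k))) \<longlonglongrightarrow> 0"
    and det_lim: "\<And>E :: real. complex_of_real E \<in> spectrum (schroedinger V) \<Longrightarrow>
      filterlim (\<lambda>k. det (P_matrix V E k)) at_top sequentially"
    and eta: "\<eta> > 0" and a: "a > 3" and tau: "\<tau> > 4"
    and b_bdd: "bounded (range b)"
    and b_decay: "\<And>n :: int. n \<ge> 1 \<Longrightarrow>
      \<bar>b n\<bar> \<le> \<eta> * (a + 2 * sup_norm V) powr (- \<tau> * real_of_int n)"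
    and kappa: "b \<noteq> (\<lambda>_. 0) \<Longrightarrow> \<bar>\<kappa>\<bar> \<le> 1 / sup_norm b" \<comment> \<open>\<open>1 / 0\<close> is read as infinity\<close>
  shows "\<exists>\<gamma> \<gamma>' :: real. \<gamma> > 0 \<and> \<gamma>' > 0 \<and>
    (\<forall>k :: nat. \<forall>E :: real. k \<ge> 1 \<longrightarrow>
      complex_of_real E \<in> spectrum (schroedinger (\<lambda>n. V n + \<kappa> * b n)) \<longrightarrow>
      (inverse \<gamma> * frobenius_norm (P_matrix V E k)
         \<le> frobenius_norm (P_matrix (\<lambda>n. V n + \<kappa> * b n) E k) \<and>
       frobenius_norm (P_matrix (\<lambda>n. V n + \<kappa> * b n) E k)
         \<le> \<gamma> * frobenius_norm (P_matrix V E k)) \<and>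
      (inverse \<gamma>' * det (P_matrix V E k)
         \<le> det (P_matrix (\<lambda>n. V n + \<kappa> * b n) E k) \<and>
       det (P_matrix (\<lambda>n. V n + \<kappa> * b n) E k)
         \<le> \<gamma>' * det (P_matrix V E k)))"
proof -
  let ?W = "\<lambda>n. V n + \<kappa> * b n"
  \<comment> \<open>The base of the decay hypothesis also bounds \<open>E - V n\<close>: a perturbed
    spectral energy has modulus at most \<open>2 + (sup_norm V + 1)\<close>, and
    \<open>3 < a\<close>.\<close>
  define M where "M = a + 2 * sup_norm V"
  note V_le = abs_le_sup_norm[OF V_bdd]
  have M: "3 \<le> M" using V_le[of 0] a by (simp add: M_def)
  have c: "0 \<le> \<bar>\<kappa>\<bar> * \<eta>" using eta by simp
  \<comment> \<open>For \<open>b = 0\<close> the product vanishes whatever the coupling; otherwise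
    the supremum is positive and the bound on the coupling can be multiplied out.\<close>
  have kb: "\<bar>\<kappa> * b n\<bar> \<le> 1" for n
  proof (cases "b = (\<lambda>_. 0)")
    case False
    then obtain m where "b m \<noteq> 0" by auto
    then have "0 < sup_norm b" using abs_le_sup_norm[OF b_bdd, of m] by linarith
    then have "\<bar>\<kappa>\<bar> * sup_norm b \<le> 1" using kappa[OF False] by (simp add: field_simps)
    then show ?thesis
      using mult_left_mono[OF abs_le_sup_norm[OF b_bdd, of n], of "\<bar>\<kappa>\<bar>"] by (simp add: abs_mult)
  qed simp
  have E: "\<bar>E - V n\<bar> \<le> M" if "complex_of_real E \<in> spectrum (schroedinger ?W)" for E n
  proof -
    have "\<bar>?W n\<bar> \<le> sup_norm V + 1" for n using V_le[of n] kb[of n] by linarith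
    from spectrum_schroedinger_bound[OF this that] show ?thesis
      using V_le[of n] a by (simp add: M_def)
  qed
  have decay: "\<bar>?W (int n) - V (int n)\<bar> \<le> \<bar>\<kappa>\<bar> * \<eta> * (1 / M ^ 4) ^ n" if "1 \<le> n" for n
  proof -
    \<comment> \<open>The real exponent is relaxed to the integer 4, for which
      \<open>cube_ratio_less_1\<close> was shown.\<close>
    have "M powr (- \<tau> * real n) \<le> M powr (- real (4 * n))"
      using M tau mult_right_mono[of 4 \<tau> "real n"] by (intro powr_mono) auto
    also have "\<dots> = inverse (M ^ (4 * n))"
      unfolding powr_minus using M by (subst powr_realpow) auto
    also have "\<dots> = (1 / M ^ 4) ^ n"
      by (simp add: power_mult power_divide inverse_eq_divide)
    finally have "\<eta> * M powr (- \<tau> * real n) \<le> \<eta> * (1 / M ^ 4) ^ n"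
      using eta by (intro mult_left_mono) auto
    then have "\<bar>b (int n)\<bar> \<le> \<eta> * (1 / M ^ 4) ^ n"
      using b_decay[of "int n"] that by (simp add: M_def)
    from mult_left_mono[OF this, of "\<bar>\<kappa>\<bar>"] show ?thesis by (simp add: abs_mult mult.assoc)
  qed
  obtain g h :: real where gh: "0 < g" "0 < h"
    and bounds: "\<And>V W E k. (\<And>n. \<bar>E - V n\<bar> \<le> M)
      \<Longrightarrow> (\<And>n :: nat. 1 \<le> n \<Longrightarrow> \<bar>W (int n) - V (int n)\<bar> \<le> \<bar>\<kappa>\<bar> * \<eta> * (1 / M ^ 4) ^ n) \<Longrightarrow> 1 \<le> k
      \<Longrightarrow> norm (P_matrix W E k) \<le> g * norm (P_matrix V E k)
        \<and> norm (P_matrix V E k) \<le> g * norm (P_matrix W E k)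
        \<and> det (P_matrix W E k) \<le> h * det (P_matrix V E k)
        \<and> det (P_matrix V E k) \<le> h * det (P_matrix W E k)"
    by (rule P_matrix_perturb_uniform[OF M c]) blast
  have inverse_le: "inverse x * y \<le> z" if "0 < x" "y \<le> x * z" for x y z :: real
    using that by (simp add: field_simps)
  show ?thesis
    unfolding frobenius_norm_eq_norm
    using gh bounds[OF E decay] by (intro exI[of _ g] exI[of _ h]) (auto intro: inverse_le)
qed

end
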